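(* Let $F(n,k)$ be a ratio of products of rational functions, exponentials, factorials, $\Gamma$ function terms, binomial coefficients, and Pochhammer symbols with rational-linear arguments in $n$ and $k$; that is, all the arguments are of the form $\frac{p_j}{q_j}n+\frac{s_j}{t_j}k+\alpha_j$ with integers $p_j,q_j,s_j,t_j$, the fractions $p_j/q_j$ and $s_j/t_j$ in lowest terms, $q_j,t_j>0$, and $\alpha_j$ independent of $n$ and $k$. Let $m:=\operatorname{lcm}\{q_j\}$, $l:=\operatorname{lcm}\{t_j\}$ and $\tilde F(n,k):=F(mn,kl)$. Then $\tilde F(n,k)$ is integer-linear in its arguments with respect to $n$ and $k$. Moreover, if Zeilberger's algorithm applied to $\tilde F(n,k)$ yields the recurrence equation $$\sum_{j=0}^{J}P_j(n)\,\tilde\Sigma(n-j)=0,\qquad \tilde\Sigma(n):=\sum_{k\in\mathbb Z}\tilde F(n,k),$$ with polynomials $P_j$ in $n$, then the sum $\Sigma(n):=\sum_{k\in\mathbb Z}F(n,k)$ satisfies the recurrence equation $$\sum_{j=0}^{J}P_j(n/m)\,\Sigma(n-jm)=0 .$$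
   Context: $F(n,k)$ is regarded as an expression (meromorphic function) in the variables $n$ and $k$, so that substitutions such as $n\mapsto mn$, $n\mapsto n/m$, $k\mapsto kl$, $k\mapsto k/l$ make sense. Exponentials are $c^x$ with nonzero $c$ independent of $n,k$; $x!=\Gamma(x+1)$; $\binom{x}{y}=\frac{\Gamma(x+1)}{\Gamma(y+1)\Gamma(x-y+1)}$; $(x)_y=\Gamma(x+y)/\Gamma(x)$; the "arguments" are the quantities $x,y$. "Integer-linear" means that the coefficients of $n$ and $k$ in all arguments are integers. Zeilberger's algorithm: for a term $\tilde F(n,k)$ for which $\tilde F(n,k)/\tilde F(n-1,k)$ and $\tilde F(n,k)/\tilde F(n,k-1)$ are rational functions of $n$ and $k$, "Zeilberger's algorithm yields the recurrence $\sum_{j=0}^J P_j(n)\tilde\Sigma(n-j)=0$" means that it finds (by Gosper's algorithm) polynomials $P_0,\dots,P_J$ in $n$, not all zero, and a term $\tilde G(n,k)$ which is a rational function multiple of $\tilde F(n,k)$ such that identically in $n$ and $k$ $$\sum_{j=0}^{J}P_j(n)\,\tilde F(n-j,k)=\tilde G(n,k)-\tilde G(n,k-1),$$ the recurrence being obtained by summation over $k$, the right-hand side being telescoping. Standing convention: the sums over $k\in\mathbb Z$ considered have natural bounds, so that they are finite and the telescoping sums contribute zero; i.e. for the values of $n$ considered only finitely many of the $F(n-jm,k)$, $k\in\mathbb Z$, are nonzero, and $\sum_{k\in\mathbb Z}\big(G(n,k)-G(n,k-l)\big)=0$ for $G(n,k):=\tilde G(n/m,k/l)$. *)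

theory Defs
  imports "HOL-Analysis.Analysis" "HOL-Computational_Algebra.Polynomial"
begin

text \<open>
  Because \<open>m\<close>, \<open>l\<close> and integer-linearity depend on the arguments occurring in a term, terms
  are represented syntactically. \<open>Arg a b \<alpha>\<close> stands for \<open>a n + b k + \<alpha>\<close>.
\<close>

datatype arg = Arg (n_coeff: rat) (k_coeff: rat) (arg_const: complex)

text \<open>
  Polynomials in \<open>n\<close> and \<open>k\<close> are polynomials in \<open>k\<close> with coefficients in \<open>\<complex>[n]\<close>;
  \<open>RatFun p q\<close> stands for \<open>p / q\<close> and \<open>Expo c x\<close> for \<open>c\<close> to the power \<open>x\<close>.
\<close>

datatype factor =
    RatFun "complex poly poly" "complex poly poly"
  | Expo complex arg
  | Factl arg
  | GammaT arg
  | Binom arg arg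
  | Pochh arg arg

datatype hterm = Ratio (numerator: "factor list") (denominator: "factor list")

definition poly2 :: "complex poly poly \<Rightarrow> complex \<Rightarrow> complex \<Rightarrow> complex" where
  "poly2 p n k = poly (poly p [:k:]) n"

fun arg_at :: "arg \<Rightarrow> complex \<Rightarrow> complex \<Rightarrow> complex" where
  "arg_at (Arg a b \<alpha>) n k = of_rat a * n + of_rat b * k + \<alpha>"

fun factor_at :: "factor \<Rightarrow> complex \<Rightarrow> complex \<Rightarrow> complex" where
  "factor_at (RatFun p q) n k = poly2 p n k / poly2 q n k"
| "factor_at (Expo c x) n k = c powr arg_at x n k"
| "factor_at (Factl x) n k = Gamma (arg_at x n k + 1)"
| "factor_at (GammaT x) n k = Gamma (arg_at x n k)"
| "factor_at (Binom x y) n k =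
     Gamma (arg_at x n k + 1) /
     (Gamma (arg_at y n k + 1) * Gamma (arg_at x n k - arg_at y n k + 1))"
| "factor_at (Pochh x y) n k = Gamma (arg_at x n k + arg_at y n k) / Gamma (arg_at x n k)"

definition term_at :: "hterm \<Rightarrow> complex \<Rightarrow> complex \<Rightarrow> complex" where
  "term_at F n k =
     (\<Prod>f\<leftarrow>numerator F. factor_at f n k) / (\<Prod>f\<leftarrow>denominator F. factor_at f n k)"

text \<open>
  Points at which a factor, respectively the reciprocal of a factor, has no pole. At these
  points the value of \<^const>\<open>term_at\<close> is the mathematical one: \<open>1 / \<Gamma>\<close> is entire, and the
  library convention \<open>Gamma z = 0\<close> at the poles of \<open>\<Gamma>\<close> together with division by zero
  gives \<open>1 / Gamma z = 0\<close> there.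
\<close>

fun factor_regular :: "factor \<Rightarrow> complex \<Rightarrow> complex \<Rightarrow> bool" where
  "factor_regular (RatFun p q) n k \<longleftrightarrow> poly2 q n k \<noteq> 0"
| "factor_regular (Expo c x) n k \<longleftrightarrow> True"
| "factor_regular (Factl x) n k \<longleftrightarrow> arg_at x n k + 1 \<notin> \<int>\<^sub>\<le>\<^sub>0"
| "factor_regular (GammaT x) n k \<longleftrightarrow> arg_at x n k \<notin> \<int>\<^sub>\<le>\<^sub>0"
| "factor_regular (Binom x y) n k \<longleftrightarrow> arg_at x n k + 1 \<notin> \<int>\<^sub>\<le>\<^sub>0"
| "factor_regular (Pochh x y) n k \<longleftrightarrow> arg_at x n k + arg_at y n k \<notin> \<int>\<^sub>\<le>\<^sub>0"

fun recip_regular :: "factor \<Rightarrow> complex \<Rightarrow> complex \<Rightarrow> bool" where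
  "recip_regular (RatFun p q) n k \<longleftrightarrow> poly2 p n k \<noteq> 0 \<and> poly2 q n k \<noteq> 0"
| "recip_regular (Expo c x) n k \<longleftrightarrow> True"
| "recip_regular (Factl x) n k \<longleftrightarrow> True"
| "recip_regular (GammaT x) n k \<longleftrightarrow> True"
| "recip_regular (Binom x y) n k \<longleftrightarrow>
     arg_at y n k + 1 \<notin> \<int>\<^sub>\<le>\<^sub>0 \<and> arg_at x n k - arg_at y n k + 1 \<notin> \<int>\<^sub>\<le>\<^sub>0"
| "recip_regular (Pochh x y) n k \<longleftrightarrow> arg_at x n k \<notin> \<int>\<^sub>\<le>\<^sub>0"

definition term_regular :: "hterm \<Rightarrow> complex \<Rightarrow> complex \<Rightarrow> bool" where
  "term_regular F n k \<longleftrightarrow>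
     (\<forall>f\<in>set (numerator F). factor_regular f n k) \<and>
     (\<forall>f\<in>set (denominator F). recip_regular f n k)"

text \<open>
  The second conjunct says that the expression is meaningful as a meromorphic function: it
  excludes identically vanishing denominators and constant factors such as \<open>\<Gamma>(0)\<close>. If it holds,
  the points that are not regular form a proper analytic subset of \<open>\<complex>\<^sup>2\<close>.
\<close>

definition well_formed :: "hterm \<Rightarrow> bool" where
  "well_formed F \<longleftrightarrow>
     (\<forall>c x. Expo c x \<in> set (numerator F) \<union> set (denominator F) \<longrightarrow> c \<noteq> 0) \<and>
     (\<exists>n k. term_regular F n k)"

fun factor_args :: "factor \<Rightarrow> arg set" where
  "factor_args (RatFun p q) = {}"
| "factor_args (Expo c x) = {x}"
| "factor_args (Factl x) = {x}"
| "factor_args (GammaT x) = {x}"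
| "factor_args (Binom x y) = {x, y}"
| "factor_args (Pochh x y) = {x, y}"

definition term_args :: "hterm \<Rightarrow> arg set" where
  "term_args F = (\<Union>f\<in>set (numerator F) \<union> set (denominator F). factor_args f)"

definition integer_linear :: "hterm \<Rightarrow> bool" where
  "integer_linear F \<longleftrightarrow> (\<forall>x\<in>term_args F. n_coeff x \<in> \<int> \<and> k_coeff x \<in> \<int>)"

text \<open>\<^const>\<open>quotient_of\<close> yields the fraction in lowest terms with positive denominator.\<close>

definition rat_denom :: "rat \<Rightarrow> nat" where
  "rat_denom r = nat (snd (quotient_of r))"

definition n_lcm :: "hterm \<Rightarrow> nat" where
  "n_lcm F = Lcm ((\<lambda>x. rat_denom (n_coeff x)) ` term_args F)"

definition k_lcm :: "hterm \<Rightarrow> nat" where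
  "k_lcm F = Lcm ((\<lambda>x. rat_denom (k_coeff x)) ` term_args F)"

definition subst_poly2 :: "nat \<Rightarrow> nat \<Rightarrow> complex poly poly \<Rightarrow> complex poly poly" where
  "subst_poly2 m l p =
     map_poly (\<lambda>c. c \<circ>\<^sub>p [:0, of_nat m:]) p \<circ>\<^sub>p [:0, [:of_nat l:]:]"

fun subst_arg :: "nat \<Rightarrow> nat \<Rightarrow> arg \<Rightarrow> arg" where
  "subst_arg m l (Arg a b \<alpha>) = Arg (a * of_nat m) (b * of_nat l) \<alpha>"

fun subst_factor :: "nat \<Rightarrow> nat \<Rightarrow> factor \<Rightarrow> factor" where
  "subst_factor m l (RatFun p q) = RatFun (subst_poly2 m l p) (subst_poly2 m l q)"
| "subst_factor m l (Expo c x) = Expo c (subst_arg m l x)"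
| "subst_factor m l (Factl x) = Factl (subst_arg m l x)"
| "subst_factor m l (GammaT x) = GammaT (subst_arg m l x)"
| "subst_factor m l (Binom x y) = Binom (subst_arg m l x) (subst_arg m l y)"
| "subst_factor m l (Pochh x y) = Pochh (subst_arg m l x) (subst_arg m l y)"

definition subst_term :: "nat \<Rightarrow> nat \<Rightarrow> hterm \<Rightarrow> hterm" where
  "subst_term m l F =
     Ratio (map (subst_factor m l) (numerator F)) (map (subst_factor m l) (denominator F))"

lemma poly2_subst: "poly2 (subst_poly2 m l p) n k = poly2 p (of_nat m * n) (of_nat l * k)"
proof (induction p)
  case 0
  show ?case by (simp add: poly2_def subst_poly2_def)
next
  case (pCons a p)
  have "map_poly (\<lambda>c. c \<circ>\<^sub>p [:0, of_nat m:]) (pCons a p) =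
      pCons (a \<circ>\<^sub>p [:0, of_nat m:]) (map_poly (\<lambda>c. c \<circ>\<^sub>p [:0, of_nat m:]) p)"
    using pCons.hyps by (intro map_poly_pCons) auto
  then show ?case
    using pCons.IH
    by (simp add: poly2_def subst_poly2_def pcompose_pCons poly_pcompose mult_ac)
qed

lemma arg_at_subst: "arg_at (subst_arg m l x) n k = arg_at x (of_nat m * n) (of_nat l * k)"
  by (cases x) (simp add: of_rat_mult mult_ac)

lemma factor_at_subst:
  "factor_at (subst_factor m l f) n k = factor_at f (of_nat m * n) (of_nat l * k)"
  by (cases f) (simp_all add: poly2_subst arg_at_subst)

lemma term_at_subst:
  "term_at (subst_term m l F) n k = term_at F (of_nat m * n) (of_nat l * k)"
  by (simp add: term_at_def subst_term_def factor_at_subst o_def)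

definition times_ratfun :: "complex poly poly \<Rightarrow> complex poly poly \<Rightarrow> hterm \<Rightarrow> hterm" where
  "times_ratfun r s F = Ratio (RatFun r s # numerator F) (denominator F)"

text \<open>
  The identity is one between meromorphic functions, hence it is only required at the points
  where all terms involved are regular; these are dense in \<open>\<complex>\<^sup>2\<close>.
\<close>

definition zeilberger_yields ::
    "hterm \<Rightarrow> nat \<Rightarrow> (nat \<Rightarrow> complex poly) \<Rightarrow> hterm \<Rightarrow> bool" where
  "zeilberger_yields F J P G \<longleftrightarrow>
     (\<exists>j\<le>J. P j \<noteq> 0) \<and>
     (\<exists>r s. s \<noteq> 0 \<and> G = times_ratfun r s F) \<and>
     (\<forall>n k. (\<forall>j\<le>J. term_regular F (n - of_nat j) k) \<and>
            term_regular G n k \<and> term_regular G n (k - 1) \<longrightarrow>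
        (\<Sum>j\<le>J. poly (P j) n * term_at F (n - of_nat j) k) =
          term_at G n k - term_at G n (k - 1))"

text \<open>
  The value at \<open>(n, k)\<close> of a meromorphic function in two variables, where \<open>k\<close> is specialised
  first: \<open>f(\<cdot>, k)\<close> is a meromorphic function of the first variable alone, which is then
  evaluated at \<open>n\<close>, removable singularities being removed. A simultaneous limit would not do:
  for integers \<open>n \<ge> k \<ge> 0\<close> the Pochhammer symbol \<open>(-n)\<^sub>k = \<Gamma>(k - n) / \<Gamma>(-n)\<close> is indeterminate at
  \<open>(n, k)\<close> as a function of two variables, but has the usual value in the present sense.
\<close>

definition has_value ::
    "(complex \<Rightarrow> complex \<Rightarrow> complex) \<Rightarrow> complex \<Rightarrow> complex \<Rightarrow> complex \<Rightarrow> bool" where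
  "has_value f n k v \<longleftrightarrow>
     (\<exists>g. (\<forall>\<^sub>F x in at n. (f x \<longlongrightarrow> g x) (at k)) \<and> (g \<longlongrightarrow> v) (at n))"

definition value_at :: "(complex \<Rightarrow> complex \<Rightarrow> complex) \<Rightarrow> complex \<Rightarrow> complex \<Rightarrow> complex" where
  "value_at f n k = (THE v. has_value f n k v)"

definition k_sum :: "(complex \<Rightarrow> complex \<Rightarrow> complex) \<Rightarrow> complex \<Rightarrow> complex" where
  "k_sum f n = (\<Sum>\<^sub>\<infinity>k::int. value_at f n (of_int k))"

text \<open>
  At the value \<open>n\<close> the sums over \<open>k\<close> are finite and the right-hand side, formed with the term
  \<open>G\<close> found by the algorithm, telescopes to zero. The
  summand of the telescoping sum is the value of the meromorphic function
  \<open>G(n/m, k/l) - G(n/m, (k-l)/l)\<close>; if \<open>G\<close> itself has values at the two points, this is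
  their difference.
\<close>

definition natural_bounds ::
    "hterm \<Rightarrow> nat \<Rightarrow> nat \<Rightarrow> nat \<Rightarrow> hterm \<Rightarrow> complex \<Rightarrow> bool" where
  "natural_bounds F m l J G n \<longleftrightarrow>
     (\<forall>j\<le>J. (\<forall>k::int. \<exists>v. has_value (term_at F) (n - of_nat (j * m)) (of_int k) v) \<and>
            finite {k::int. value_at (term_at F) (n - of_nat (j * m)) (of_int k) \<noteq> 0}) \<and>
     k_sum (\<lambda>x y. term_at G (x / of_nat m) (y / of_nat l) -
                  term_at G (x / of_nat m) ((y - of_nat l) / of_nat l)) n = 0"

end

theory Submission
  imports Defs
begin

text \<open>
  The points where a well-formed term is regular avoid lines and zero sets of polynomials. Hence
  near any \<open>(n, k)\<close>, for all \<open>x \<noteq> n\<close> close to \<open>n\<close>, the points \<open>(x, y)\<close> with \<open>y \<noteq> k\<close> close enough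
  to \<open>k\<close> (depending on \<open>x\<close>) are regular. So the identity found by Zeilberger's algorithm, taken at
  \<open>(x/m, y/l)\<close>, survives the limit \<open>y \<rightarrow> k\<close> followed by \<open>x \<rightarrow> n\<close>; the resulting identity of
  values is summed over \<open>k\<close>.
\<close>

section \<open>Generic points and affine substitutions\<close>

text \<open>The order of the two quantifiers is that of the iterated limit in \<^const>\<open>has_value\<close>.\<close>

definition generic :: "(complex \<Rightarrow> complex \<Rightarrow> bool) \<Rightarrow> bool" where
  "generic R \<longleftrightarrow> (\<forall>a b. \<forall>\<^sub>F x in at a. \<forall>\<^sub>F y in at b. R x y)"

lemma generic_True: "generic (\<lambda>x y. True)"
  by (simp add: generic_def)

lemma generic_mono:
  assumes "generic R" "\<And>x y. R x y \<Longrightarrow> S x y"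
  shows "generic S"
  unfolding generic_def
proof (intro allI)
  fix a b
  have "\<forall>\<^sub>F x in at a. \<forall>\<^sub>F y in at b. R x y"
    using assms(1) by (simp add: generic_def)
  then show "\<forall>\<^sub>F x in at a. \<forall>\<^sub>F y in at b. S x y"
    by (rule eventually_mono) (erule eventually_mono, rule assms(2))
qed

lemma generic_conj: "generic R \<Longrightarrow> generic S \<Longrightarrow> generic (\<lambda>x y. R x y \<and> S x y)"
  by (simp add: generic_def eventually_conj_iff)

lemma generic_ball:
  assumes "finite A" "\<And>i. i \<in> A \<Longrightarrow> generic (R i)"
  shows "generic (\<lambda>x y. \<forall>i\<in>A. R i x y)"
  using assms by (simp add: generic_def eventually_ball_finite_distrib)

text \<open>For \<open>c\<close> nonzero the map is injective as well as continuous, so punctured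
  neighbourhoods go into punctured neighbourhoods.\<close>

lemma filterlim_affine_at:
  fixes c d a :: complex
  assumes "c \<noteq> 0"
  shows "filterlim (\<lambda>x. c * x + d) (at (c * a + d)) (at a)"
  using assms
  by (auto simp: filterlim_at eventually_at_filter intro!: tendsto_intros)

lemma generic_affine_subst:
  assumes "generic R" "c \<noteq> 0" "e \<noteq> 0"
  shows "generic (\<lambda>x y. R (c * x + d) (e * y + f))"
  unfolding generic_def
proof (intro allI)
  fix a b
  have "\<forall>\<^sub>F x in at (c * a + d). \<forall>\<^sub>F y in at (e * b + f). R x y"
    using assms(1) by (simp add: generic_def)
  then have "\<forall>\<^sub>F x in at a. \<forall>\<^sub>F y in at (e * b + f). R (c * x + d) y"
    by (rule eventually_compose_filterlim[OF _ filterlim_affine_at[OF assms(2)]])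
  then show "\<forall>\<^sub>F x in at a. \<forall>\<^sub>F y in at b. R (c * x + d) (e * y + f)"
    by eventually_elim (rule eventually_compose_filterlim[OF _ filterlim_affine_at[OF assms(3)]])
qed

section \<open>Poles of Gamma, zeros of polynomials, and genericity of regular points\<close>

lemma eventually_affine_notin_nonpos_Ints:
  fixes c d a :: complex
  assumes "c \<noteq> 0"
  shows "\<forall>\<^sub>F x in at a. c * x + d \<notin> \<int>\<^sub>\<le>\<^sub>0"
proof -
  \<comment> \<open>The centre may itself be a pole. Removing it leaves a set of integers, hence a
    closed set, and the punctured neighbourhood ignores the centre anyway.\<close>
  have "\<int>\<^sub>\<le>\<^sub>0 - {c * a + d} \<subseteq> (\<int> :: complex set)"
    using nonpos_Ints_subset_Ints by blast
  then have "open (- (\<int>\<^sub>\<le>\<^sub>0 - {c * a + d}))"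
    by (intro open_Compl closed_subset_Ints)
  then have "\<forall>\<^sub>F x in at (c * a + d). x \<in> - (\<int>\<^sub>\<le>\<^sub>0 - {c * a + d})"
    by (intro eventually_at_in_open') auto
  then have "\<forall>\<^sub>F x in at (c * a + d). x \<notin> \<int>\<^sub>\<le>\<^sub>0"
    by (simp add: eventually_at_filter)
  then show ?thesis
    by (rule eventually_compose_filterlim[OF _ filterlim_affine_at[OF assms]])
qed

text \<open>If \<open>b\<close> is nonzero, the inner variable avoids the poles for every
  \<open>x\<close>; if only \<open>a\<close> is nonzero, the outer one does. If both vanish, the
  form is constant, and the single good point decides.\<close>

lemma generic_affine_notin_nonpos_Ints:
  assumes "a * x0 + b * y0 + c \<notin> \<int>\<^sub>\<le>\<^sub>0"
  shows "generic (\<lambda>x y. a * x + b * y + c \<notin> \<int>\<^sub>\<le>\<^sub>0)"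
proof (cases "b = 0")
  case False
  then have "\<forall>\<^sub>F y in at k. a * x + b * y + c \<notin> \<int>\<^sub>\<le>\<^sub>0" for x k
    using eventually_affine_notin_nonpos_Ints[of b "a * x + c" k] by (simp add: add_ac)
  then show ?thesis
    by (simp add: generic_def)
next
  case b: True
  show ?thesis
  proof (cases "a = 0")
    case True
    then show ?thesis
      using assms b by (simp add: generic_def)
  next
    case False
    have "\<forall>\<^sub>F x in at n. \<forall>\<^sub>F y in at k. a * x + b * y + c \<notin> \<int>\<^sub>\<le>\<^sub>0" for n and k :: complex
      using eventually_affine_notin_nonpos_Ints[OF False, of c n]
      by eventually_elim (simp add: b)
    then show ?thesis
      by (simp add: generic_def)
  qed
qed

text \<open>Fixing \<open>x\<close> first matches the order of the iterated limit and leaves a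
  polynomial in one variable.\<close>

lemma poly2_conv_map_poly: "poly2 p x y = poly (map_poly (\<lambda>c. poly c x) p) y"
proof (induction p)
  case (pCons a p)
  then have "map_poly (\<lambda>c. poly c x) (pCons a p) = pCons (poly a x) (map_poly (\<lambda>c. poly c x) p)"
    by (intro map_poly_pCons) auto
  with pCons.IH show ?case
    by (simp add: poly2_def)
qed (simp add: poly2_def)

lemma eventually_poly_nonzero:
  fixes p :: "complex poly"
  assumes "p \<noteq> 0"
  shows "\<forall>\<^sub>F x in at a. poly p x \<noteq> 0"
proof -
  have "\<not> a islimpt {x. poly p x = 0}"
    using poly_roots_finite[OF assms] by (simp add: islimpt_finite)
  then show ?thesis
    by (simp add: islimpt_iff_eventually)
qed

text \<open>Near \<open>a\<close> the outer variable avoids the roots of the leading coefficient in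
  \<open>y\<close>. The specialised polynomial is then nonzero, and \<open>y\<close> avoids its
  finitely many roots.\<close>

lemma generic_poly2_nonzero:
  assumes "p \<noteq> 0"
  shows "generic (\<lambda>x y. poly2 p x y \<noteq> 0)"
  unfolding generic_def
proof (intro allI)
  fix a b
  from assms have "\<forall>\<^sub>F x in at a. poly (lead_coeff p) x \<noteq> 0"
    by (intro eventually_poly_nonzero) simp
  then show "\<forall>\<^sub>F x in at a. \<forall>\<^sub>F y in at b. poly2 p x y \<noteq> 0"
  proof eventually_elim
    case (elim x)
    then have "coeff (map_poly (\<lambda>c. poly c x) p) (degree p) \<noteq> 0"
      by (simp add: coeff_map_poly)
    then have "map_poly (\<lambda>c. poly c x) p \<noteq> 0"
      by auto
    then show ?case
      unfolding poly2_conv_map_poly by (rule eventually_poly_nonzero)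
  qed
qed

lemma generic_poly2_nonzeroI: "poly2 p x0 y0 \<noteq> 0 \<Longrightarrow> generic (\<lambda>x y. poly2 p x y \<noteq> 0)"
  by (rule generic_poly2_nonzero) (auto simp: poly2_def)

lemma arg_at_eq:
  "arg_at u x y = of_rat (n_coeff u) * x + of_rat (k_coeff u) * y + arg_const u"
  by (cases u) simp

lemma generic_arg_notin_nonpos_Ints:
  assumes "arg_at u x0 y0 + d \<notin> \<int>\<^sub>\<le>\<^sub>0"
  shows "generic (\<lambda>x y. arg_at u x y + d \<notin> \<int>\<^sub>\<le>\<^sub>0)"
  using assms
    generic_affine_notin_nonpos_Ints[of "of_rat (n_coeff u)" x0 "of_rat (k_coeff u)" y0 "arg_const u + d"]
  by (simp add: arg_at_eq add_ac)

lemma generic_arg_sum_notin_nonpos_Ints: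
  assumes "arg_at u x0 y0 + arg_at v x0 y0 \<notin> \<int>\<^sub>\<le>\<^sub>0"
  shows "generic (\<lambda>x y. arg_at u x y + arg_at v x y \<notin> \<int>\<^sub>\<le>\<^sub>0)"
  using assms
    generic_affine_notin_nonpos_Ints[of "of_rat (n_coeff u) + of_rat (n_coeff v)" x0
      "of_rat (k_coeff u) + of_rat (k_coeff v)" y0 "arg_const u + arg_const v"]
  by (simp add: arg_at_eq algebra_simps)

lemma generic_arg_diff_notin_nonpos_Ints:
  assumes "arg_at u x0 y0 - arg_at v x0 y0 + d \<notin> \<int>\<^sub>\<le>\<^sub>0"
  shows "generic (\<lambda>x y. arg_at u x y - arg_at v x y + d \<notin> \<int>\<^sub>\<le>\<^sub>0)"
  using assms
    generic_affine_notin_nonpos_Ints[of "of_rat (n_coeff u) - of_rat (n_coeff v)" x0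
      "of_rat (k_coeff u) - of_rat (k_coeff v)" y0 "arg_const u - arg_const v + d"]
  by (simp add: arg_at_eq algebra_simps)

lemma generic_factor_regular:
  assumes "factor_regular f x0 y0"
  shows "generic (\<lambda>x y. factor_regular f x y)"
  using assms
  by (cases f)
    (simp_all add: generic_True generic_poly2_nonzeroI generic_arg_notin_nonpos_Ints
      generic_arg_notin_nonpos_Ints[where d = 0, simplified] generic_arg_sum_notin_nonpos_Ints)

lemma generic_recip_regular:
  assumes "recip_regular f x0 y0"
  shows "generic (\<lambda>x y. recip_regular f x y)"
  using assms
  by (cases f)
    (auto intro!: generic_conj simp: generic_True generic_poly2_nonzeroI generic_arg_notin_nonpos_Ints
      generic_arg_notin_nonpos_Ints[where d = 0, simplified] generic_arg_diff_notin_nonpos_Ints)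

text \<open>Each regularity condition excludes poles along lines or zeros of polynomials, so one
  regular point rules out the degenerate cases. \<open>well_formed\<close> supplies that
  point.\<close>

lemma generic_term_regular:
  assumes "term_regular F x0 y0"
  shows "generic (term_regular F)"
  using assms unfolding term_regular_def[abs_def]
  by (intro generic_conj generic_ball finite_set)
    (auto intro: generic_factor_regular generic_recip_regular)

lemma factor_regular_subst:
  "factor_regular (subst_factor m l f) n k = factor_regular f (of_nat m * n) (of_nat l * k)"
  by (cases f) (simp_all add: poly2_subst arg_at_subst)

lemma recip_regular_subst:
  "recip_regular (subst_factor m l f) n k = recip_regular f (of_nat m * n) (of_nat l * k)"
  by (cases f) (simp_all add: poly2_subst arg_at_subst)

lemma term_regular_subst:
  "term_regular (subst_term m l F) n k = term_regular F (of_nat m * n) (of_nat l * k)"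
  by (simp add: term_regular_def subst_term_def factor_regular_subst recip_regular_subst)

lemma term_regular_times_ratfun:
  "term_regular (times_ratfun r s F) n k \<longleftrightarrow> poly2 s n k \<noteq> 0 \<and> term_regular F n k"
  by (auto simp: term_regular_def times_ratfun_def)

section \<open>Calculus of iterated limits\<close>

lemma has_value_unique:
  assumes "has_value f n k v" "has_value f n k w"
  shows "v = w"
proof -
  obtain g where g: "\<forall>\<^sub>F x in at n. (f x \<longlongrightarrow> g x) (at k)" "(g \<longlongrightarrow> v) (at n)"
    using assms(1) by (auto simp: has_value_def)
  obtain h where h: "\<forall>\<^sub>F x in at n. (f x \<longlongrightarrow> h x) (at k)" "(h \<longlongrightarrow> w) (at n)"
    using assms(2) by (auto simp: has_value_def)
  have "\<forall>\<^sub>F x in at n. g x = h x"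
    using g(1) h(1) by eventually_elim (metis tendsto_unique trivial_limit_at)
  with g(2) have "(h \<longlongrightarrow> v) (at n)"
    by (simp add: tendsto_cong)
  with h(2) show ?thesis
    by (metis tendsto_unique trivial_limit_at)
qed

lemma value_at_eq: "has_value f n k v \<Longrightarrow> value_at f n k = v"
  unfolding value_at_def by (blast intro: has_value_unique)

lemma has_value_value_at: "has_value f n k v \<Longrightarrow> has_value f n k (value_at f n k)"
  using value_at_eq by simp

lemma has_value_shift:
  assumes "has_value f (n - d) k v"
  shows "has_value (\<lambda>x. f (x - d)) n k v"
proof -
  obtain g where g: "\<forall>\<^sub>F x in at (n - d). (f x \<longlongrightarrow> g x) (at k)" "(g \<longlongrightarrow> v) (at (n - d))"
    using assms by (auto simp: has_value_def)
  have lim: "filterlim (\<lambda>x. x - d) (at (n - d)) (at n)"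
    using filterlim_affine_at[of 1 "- d" n] by simp
  show ?thesis
    unfolding has_value_def
    using eventually_compose_filterlim[OF g(1) lim] filterlim_compose[OF g(2) lim]
    by (intro exI conjI)
qed

text \<open>The factor depends on the outer variable only: it is a constant in the inner limit, and
  continuity is used in the outer one. It is meant for the coefficients \<open>P j\<close>.\<close>

lemma has_value_mult_left:
  assumes "has_value f n k v" "isCont c n"
  shows "has_value (\<lambda>x y. c x * f x y) n k (c n * v)"
proof -
  obtain g where g: "\<forall>\<^sub>F x in at n. (f x \<longlongrightarrow> g x) (at k)" "(g \<longlongrightarrow> v) (at n)"
    using assms(1) by (auto simp: has_value_def)
  have "\<forall>\<^sub>F x in at n. ((\<lambda>y. c x * f x y) \<longlongrightarrow> c x * g x) (at k)"
    using g(1) by eventually_elim (intro tendsto_intros)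
  moreover have "((\<lambda>x. c x * g x) \<longlongrightarrow> c n * v) (at n)"
    using g(2) assms(2) by (intro tendsto_intros) (simp_all add: isCont_def)
  ultimately show ?thesis
    unfolding has_value_def by (intro exI conjI)
qed

lemma has_value_sum:
  assumes "finite A" "\<And>i. i \<in> A \<Longrightarrow> has_value (f i) n k (v i)"
  shows "has_value (\<lambda>x y. \<Sum>i\<in>A. f i x y) n k (\<Sum>i\<in>A. v i)"
proof -
  obtain g where g: "\<And>i. i \<in> A \<Longrightarrow> \<forall>\<^sub>F x in at n. (f i x \<longlongrightarrow> g i x) (at k)"
      "\<And>i. i \<in> A \<Longrightarrow> (g i \<longlongrightarrow> v i) (at n)"
    using assms(2) unfolding has_value_def by metis
  have "\<forall>\<^sub>F x in at n. \<forall>i\<in>A. (f i x \<longlongrightarrow> g i x) (at k)"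
    using assms(1) g(1) by (simp add: eventually_ball_finite_distrib)
  then have "\<forall>\<^sub>F x in at n. ((\<lambda>y. \<Sum>i\<in>A. f i x y) \<longlongrightarrow> (\<Sum>i\<in>A. g i x)) (at k)"
    by eventually_elim (simp add: tendsto_sum)
  moreover have "((\<lambda>x. \<Sum>i\<in>A. g i x) \<longlongrightarrow> (\<Sum>i\<in>A. v i)) (at n)"
    using g(2) by (intro tendsto_sum)
  ultimately show ?thesis
    unfolding has_value_def by (intro exI conjI)
qed

text \<open>Both limits run over punctured neighbourhoods, so the values at exceptional points,
  which reflect library conventions, have no influence.\<close>

lemma has_value_cong_generic:
  assumes "has_value f n k v" "generic (\<lambda>x y. f x y = h x y)"
  shows "has_value h n k v"
proof -
  obtain g where g: "\<forall>\<^sub>F x in at n. (f x \<longlongrightarrow> g x) (at k)" "(g \<longlongrightarrow> v) (at n)"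
    using assms(1) by (auto simp: has_value_def)
  have "\<forall>\<^sub>F x in at n. \<forall>\<^sub>F y in at k. f x y = h x y"
    using assms(2) by (simp add: generic_def)
  with g(1) have "\<forall>\<^sub>F x in at n. (h x \<longlongrightarrow> g x) (at k)"
    by eventually_elim (simp add: tendsto_cong)
  with g(2) show ?thesis
    unfolding has_value_def by blast
qed

section \<open>Common denominators and integer-linearity\<close>

lemma finite_term_args: "finite (term_args F)"
proof -
  have "finite (factor_args f)" for f
    by (cases f) auto
  then show ?thesis
    by (simp add: term_args_def)
qed

lemma rat_denom_pos: "rat_denom r > 0"
  by (simp add: rat_denom_def quotient_of_denom_pos')

text \<open>\<open>Lcm\<close> is 0 on infinite sets and on sets containing 0; finiteness and
  positive denominators exclude both. Positivity of \<open>m\<close> and \<open>l\<close> makes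
  \<open>x / m\<close> and \<open>y / l\<close> genuine rescalings.\<close>

lemma Lcm_image_rat_denom_pos:
  assumes "finite A"
  shows "Lcm ((\<lambda>u. rat_denom (f u)) ` A) > 0"
proof -
  have "0 \<notin> (\<lambda>u. rat_denom (f u)) ` A"
    using rat_denom_pos by (metis imageE less_irrefl)
  then show ?thesis
    using assms by (simp add: Lcm_0_iff zero_less_iff_neq_zero)
qed

lemma n_lcm_pos: "n_lcm F > 0" and k_lcm_pos: "k_lcm F > 0"
  unfolding n_lcm_def k_lcm_def by (rule Lcm_image_rat_denom_pos[OF finite_term_args])+

text \<open>With \<open>r = p / q\<close> and \<open>m = q * c\<close> the product is
  \<open>p * c\<close>.\<close>

lemma rat_mult_denom_multiple_in_Ints:
  assumes "rat_denom r dvd m"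
  shows "r * of_nat m \<in> \<int>"
proof -
  obtain p q where pq: "quotient_of r = (p, q)"
    by fastforce
  then have q: "q > 0" "r = of_int p / of_int q"
    using quotient_of_denom_pos quotient_of_div by auto
  from assms obtain c where "m = nat q * c"
    by (auto simp: rat_denom_def pq)
  then have "(of_nat m :: rat) = of_int q * of_nat c"
    using q by (simp add: of_nat_nat)
  with q have "r * of_nat m = of_int (p * int c)"
    by simp
  then show ?thesis
    by (simp only: Ints_of_int)
qed

lemma factor_args_subst: "factor_args (subst_factor m l f) = subst_arg m l ` factor_args f"
  by (cases f) auto

lemma term_args_subst: "term_args (subst_term m l F) = subst_arg m l ` term_args F"
  by (auto simp: term_args_def subst_term_def factor_args_subst)

lemma integer_linear_subst: "integer_linear (subst_term (n_lcm F) (k_lcm F) F)"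
proof -
  have "n_coeff (subst_arg (n_lcm F) (k_lcm F) u) \<in> \<int> \<and>
      k_coeff (subst_arg (n_lcm F) (k_lcm F) u) \<in> \<int>" if "u \<in> term_args F" for u
    using that
    by (cases u) (auto simp: n_lcm_def k_lcm_def intro!: rat_mult_denom_multiple_in_Ints dvd_Lcm
        rev_image_eqI)
  then show ?thesis
    by (auto simp: integer_linear_def term_args_subst)
qed

section \<open>The telescoping identity and its summation\<close>

text \<open>Undoing the substitution at \<open>(x / m, y / l)\<close> turns the shift of the first
  variable by \<open>j\<close> into \<open>j * m\<close> and the shift of the second by 1 into
  \<open>l\<close>.\<close>

lemma generic_telescoping_identity:
  assumes "term_regular F x0 y0" "m > 0" "l > 0"
    and "zeilberger_yields (subst_term m l F) J P G"
  shows "generic (\<lambda>x y.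
    (\<Sum>j\<le>J. poly (P j) (x / of_nat m) * term_at F (x - of_nat (j * m)) y) =
      term_at G (x / of_nat m) (y / of_nat l) -
      term_at G (x / of_nat m) ((y - of_nat l) / of_nat l))"
    (is "generic ?E")
proof -
  let ?Ft = "subst_term m l F"
  obtain r s where rs: "s \<noteq> 0" "G = times_ratfun r s ?Ft"
    using assms(4) by (auto simp: zeilberger_yields_def)
  have "term_regular ?Ft (x0 / of_nat m) (y0 / of_nat l)"
    using assms(1-3) by (simp add: term_regular_subst)
  then have Ft: "generic (term_regular ?Ft)"
    by (rule generic_term_regular)
  \<comment> \<open>\<open>G\<close> is a rational multiple of \<open>?Ft\<close>, so its regularity
    adds only the nonvanishing of the denominator \<open>s\<close>.\<close>
  then have G: "generic (term_regular G)"
    using generic_conj[OF generic_poly2_nonzero[OF rs(1)] Ft]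
    by (simp add: rs(2) term_regular_times_ratfun[abs_def])
  have resc: "generic (\<lambda>x y. R (x / of_nat m - d) (y / of_nat l - e))"
    if "generic R" for R d e
    using generic_affine_subst[OF that, of "1 / of_nat m" "1 / of_nat l" "- d" "- e"] assms(2,3)
    by simp
  \<comment> \<open>The summands \<open>- 0\<close> give every conjunct the shape of
    \<open>resc\<close>.\<close>
  have "generic (\<lambda>x y. (\<forall>j\<in>{..J}. term_regular ?Ft (x / of_nat m - of_nat j) (y / of_nat l - 0)) \<and>
      term_regular G (x / of_nat m - 0) (y / of_nat l - 0) \<and>
      term_regular G (x / of_nat m - 0) (y / of_nat l - 1))" (is "generic ?R")
    by (intro generic_conj generic_ball resc Ft G finite_atMost)
  moreover have "?E x y" if "?R x y" for x y
  proof -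
    have "(\<Sum>j\<le>J. poly (P j) (x / of_nat m) * term_at ?Ft (x / of_nat m - of_nat j) (y / of_nat l)) =
        term_at G (x / of_nat m) (y / of_nat l) - term_at G (x / of_nat m) (y / of_nat l - 1)"
      using assms(4) that unfolding zeilberger_yields_def by simp
    moreover have "term_at ?Ft (x / of_nat m - of_nat j) (y / of_nat l) =
        term_at F (x - of_nat (j * m)) y" for j
      using assms(2,3) by (simp add: term_at_subst right_diff_distrib mult.commute)
    moreover have "(y - of_nat l) / of_nat l = y / of_nat l - 1"
      using assms(3) by (simp add: field_simps)
    ultimately show ?thesis
      by simp
  qed
  ultimately show ?thesis
    by (rule generic_mono)
qed

lemma infsum_finite_support:
  fixes f :: "'a \<Rightarrow> complex"
  assumes "finite A" "\<And>x. x \<notin> A \<Longrightarrow> f x = 0"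
  shows "infsum f UNIV = sum f A"
proof -
  have "infsum f UNIV = infsum f A"
    by (rule infsum_cong_neutral) (use assms in auto)
  then show ?thesis
    using assms(1) by simp
qed

text \<open>At each integer \<open>k\<close> the value of the telescoping difference
  \<open>D\<close> is the combination of the values of \<open>F\<close>. Summing over
  \<open>k\<close> gives the left-hand side of the recurrence, while \<open>natural_bounds\<close>
  makes the sum of \<open>D\<close> zero.\<close>

lemma k_sum_recurrence:
  assumes "term_regular F x0 y0" "m > 0" "l > 0"
    and "zeilberger_yields (subst_term m l F) J P G"
    and "natural_bounds F m l J G n"
  shows "(\<Sum>j\<le>J. poly (P j) (n / of_nat m) * k_sum (term_at F) (n - of_nat (j * m))) = 0"
proof -
  define v where "v j k = value_at (term_at F) (n - of_nat (j * m)) (of_int k)" for j and k :: int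
  define D where "D = (\<lambda>x y. term_at G (x / of_nat m) (y / of_nat l) -
      term_at G (x / of_nat m) ((y - of_nat l) / of_nat l))"
  have fin: "finite {k. v j k \<noteq> 0}" if "j \<le> J" for j
    using assms(5) that by (simp add: natural_bounds_def v_def)
  have D_sum: "k_sum D n = 0"
    using assms(5) by (simp add: natural_bounds_def D_def)
  have D_val: "value_at D n (of_int k) = (\<Sum>j\<le>J. poly (P j) (n / of_nat m) * v j k)" for k
  proof -
    have "has_value (\<lambda>x y. poly (P j) (x / of_nat m) * term_at F (x - of_nat (j * m)) y) n (of_int k)
        (poly (P j) (n / of_nat m) * v j k)" if "j \<le> J" for j
    proof -
      have "has_value (term_at F) (n - of_nat (j * m)) (of_int k) (v j k)"
        using assms(5) that unfolding natural_bounds_def v_def by (blast intro: has_value_value_at)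
      then show ?thesis
        using assms(2) by (intro has_value_mult_left has_value_shift continuous_intros) auto
    qed
    then have "has_value
        (\<lambda>x y. \<Sum>j\<le>J. poly (P j) (x / of_nat m) * term_at F (x - of_nat (j * m)) y) n (of_int k)
        (\<Sum>j\<le>J. poly (P j) (n / of_nat m) * v j k)"
      by (intro has_value_sum) auto
    \<comment> \<open>The existence of a value for \<open>D\<close> is derived here: it is inherited
      from the values of \<open>F\<close>, which exist by \<open>natural_bounds\<close>.\<close>
    from has_value_cong_generic[OF this generic_telescoping_identity[OF assms(1-4)]]
    show ?thesis
      unfolding D_def by (rule value_at_eq)
  qed
  \<comment> \<open>One finite set supports the summands for all shifts \<open>j\<close> and, by
    \<open>D_val\<close>, those of \<open>D\<close>, so only finite sums are interchanged.\<close>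
  define A where "A = (\<Union>j\<le>J. {k. v j k \<noteq> 0})"
  have A: "finite A" "\<And>j k. j \<le> J \<Longrightarrow> k \<notin> A \<Longrightarrow> v j k = 0"
    using fin by (auto simp: A_def)
  have "(\<Sum>j\<le>J. poly (P j) (n / of_nat m) * k_sum (term_at F) (n - of_nat (j * m))) =
      (\<Sum>j\<le>J. poly (P j) (n / of_nat m) * (\<Sum>k\<in>A. v j k))"
    unfolding k_sum_def v_def[symmetric]
    by (intro sum.cong refl arg_cong2[where f = "(*)"] infsum_finite_support) (use A in auto)
  also have "\<dots> = (\<Sum>k\<in>A. \<Sum>j\<le>J. poly (P j) (n / of_nat m) * v j k)"
    unfolding sum_distrib_left by (rule sum.swap)
  also have "\<dots> = k_sum D n"
    unfolding k_sum_def D_val using A by (intro infsum_finite_support[symmetric]) simp_all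
  finally show ?thesis
    by (simp add: D_sum)
qed

theorem mainTheorem3:
  fixes F Ft :: hterm and m l :: nat
  assumes "well_formed F"
    and "m = n_lcm F"
    and "l = k_lcm F"
    and "Ft = subst_term m l F"
  shows "integer_linear Ft \<and>
    (\<forall>(J::nat) (P :: nat \<Rightarrow> complex poly) (Gt :: hterm).
       zeilberger_yields Ft J P Gt \<longrightarrow>
       (\<forall>n::complex. natural_bounds F m l J Gt n \<longrightarrow>
          (\<Sum>j\<le>J. poly (P j) (n / of_nat m) * k_sum (term_at F) (n - of_nat (j * m))) = 0))"
proof -
  obtain x0 y0 where "term_regular F x0 y0"
    using assms(1) by (auto simp: well_formed_def)
  from k_sum_recurrence[OF this n_lcm_pos k_lcm_pos] show ?thesis
    unfolding assms(2-4) using integer_linear_subst by simp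
qed

end
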